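(* Let $x\in\mathbb{C}^n$ be a vector whose first two non-zero entries $x_{j_1},x_{j_2}$ (in order of index) exist and are not collinear with $0$ when $\mathbb{C}$ is regarded as the real plane $\mathbb{R}^2$. Then the Two-Stage Complex Phase Retrieval algorithm (described in the context) exactly recovers $x$ up to a global phase: the algorithm has an output, and every vector $\hat{x}\in\mathbb{C}^n$ it outputs satisfies $\hat{x}\sim x$, i.e. $\hat{x}=e^{i\theta}x$ for some $\theta\in\mathbb{R}$.
   Context: Phase retrieval: recover an unknown $x\in\mathbb{C}^n$ from phaseless intensity measurements $|\langle x,\phi\rangle|^2$, where the measurement vectors $\phi\in\mathbb{C}^n$ may be chosen freely (and adaptively). Here $\langle x,\phi\rangle=\phi^H x$, $e_j$ is the $j$-th standard basis vector, and $x\sim y$ means $y=e^{i\theta}x$ for some $\theta\in\mathbb{R}$. Two-Stage Complex Phase Retrieval algorithm. Stage 1. (1) Take the measurements $w_j=|\langle e_j,x\rangle|^2=|x_j|^2$ for $j=1,\dots,n$. (2) Determine from these the sparsity $s$ (the number of non-zero entries of $x$) and the indices $j_1<\dots<j_s$ of the non-zero entries. (3) Take the two measurements $z_1=|\langle e_{j_1}+e_{j_2},x\rangle|^2=|x_{j_1}+x_{j_2}|^2$ and $z_2=|\langle e_{j_1}-ie_{j_2},x\rangle|^2=|x_{j_1}+ix_{j_2}|^2$, and localize the anchors, i.e. choose $\hat{x}_{j_1},\hat{x}_{j_2}\in\mathbb{C}$ with $|\hat{x}_{j_1}|^2=w_{j_1}$, $|\hat{x}_{j_2}|^2=w_{j_2}$,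 $|\hat{x}_{j_1}+\hat{x}_{j_2}|^2=z_1$, $|\hat{x}_{j_1}+i\hat{x}_{j_2}|^2=z_2$. Stage 2. (4) For each $k=3,\dots,s$, take the measurements $w_{j_k1}=|\langle e_{j_k}-e_{j_1},x\rangle|^2$ and $w_{j_k2}=|\langle e_{j_k}-e_{j_2},x\rangle|^2$, and let $\hat{x}_{j_k}\in\mathbb{C}$ be a solution of the system $|\hat{x}_{j_k}|^2=w_{j_k}$, $|\hat{x}_{j_k}-\hat{x}_{j_1}|^2=w_{j_k1}$, $|\hat{x}_{j_k}-\hat{x}_{j_2}|^2=w_{j_k2}$. The output is the vector $\hat{x}\in\mathbb{C}^n$ with these entries at the indices $j_1,\dots,j_s$ and zeros elsewhere. *)

theory Defs
  imports
    "HOL-Analysis.Linear_Algebra"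
    "Jordan_Normal_Form.Conjugate"
    "Jordan_Normal_Form.Matrix"
begin

(* Vectors of C^n are the elements of carrier_vec n, with indices 0, ..., n - 1.
   x \<bullet>c \<phi> is the sum of x_i * cnj \<phi>_i, that is \<phi>^H x. *)
definition intensity :: "complex vec \<Rightarrow> complex vec \<Rightarrow> real" where
  "intensity x \<phi> = (cmod (x \<bullet>c \<phi>))\<^sup>2"

definition phase_equiv :: "complex vec \<Rightarrow> complex vec \<Rightarrow> bool" (infix "\<sim>\<^sub>p" 50) where
  "x \<sim>\<^sub>p y \<longleftrightarrow> (\<exists>\<theta>::real. y = exp (\<i> * complex_of_real \<theta>) \<cdot>\<^sub>v x)"

(* The algorithm accesses the unknown vector only through a measurement oracle m,
   to be instantiated with intensity x. *)

(* The increasing list [j_1, ..., j_s] of the indices found to be non-zero;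
   its length is the sparsity s, and j_k is the entry at position k - 1. *)
definition detected_support :: "nat \<Rightarrow> (complex vec \<Rightarrow> real) \<Rightarrow> nat list" where
  "detected_support n m = filter (\<lambda>j. m (unit_vec n j) \<noteq> 0) [0..<n]"

definition anchors_localized ::
    "nat \<Rightarrow> (complex vec \<Rightarrow> real) \<Rightarrow> nat \<Rightarrow> nat \<Rightarrow> complex \<Rightarrow> complex \<Rightarrow> bool" where
  "anchors_localized n m j1 j2 a b \<longleftrightarrow>
     (cmod a)\<^sup>2 = m (unit_vec n j1) \<and>
     (cmod b)\<^sup>2 = m (unit_vec n j2) \<and>
     (cmod (a + b))\<^sup>2 = m (unit_vec n j1 + unit_vec n j2) \<and>
     (cmod (a + \<i> * b))\<^sup>2 = m (unit_vec n j1 - \<i> \<cdot>\<^sub>v unit_vec n j2)"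

definition entry_solved ::
    "nat \<Rightarrow> (complex vec \<Rightarrow> real) \<Rightarrow> nat \<Rightarrow> nat \<Rightarrow> complex \<Rightarrow> complex \<Rightarrow> nat \<Rightarrow> complex \<Rightarrow> bool" where
  "entry_solved n m j1 j2 a b j c \<longleftrightarrow>
     (cmod c)\<^sup>2 = m (unit_vec n j) \<and>
     (cmod (c - a))\<^sup>2 = m (unit_vec n j - unit_vec n j1) \<and>
     (cmod (c - b))\<^sup>2 = m (unit_vec n j - unit_vec n j2)"

(* The algorithm makes choices, so it is a relation between the oracle and the
   possible outputs y. With fewer than two detected indices there are no anchors
   and hence no output. *)
definition two_stage_output ::
    "nat \<Rightarrow> (complex vec \<Rightarrow> real) \<Rightarrow> complex vec \<Rightarrow> bool" where
  "two_stage_output n m y \<longleftrightarrow>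
     (let J = detected_support n m; s = length J; j1 = J ! 0; j2 = J ! 1 in
        y \<in> carrier_vec n \<and> 2 \<le> s \<and>
        anchors_localized n m j1 j2 (y $ j1) (y $ j2) \<and>
        (\<forall>k\<in>{2..<s}. entry_solved n m j1 j2 (y $ j1) (y $ j2) (J ! k) (y $ (J ! k))) \<and>
        (\<forall>j<n. j \<notin> set J \<longrightarrow> y $ j = 0))"

end

theory Submission
  imports Defs
begin

text \<open>
  Only relative phases matter, so the proof fixes the gauge with the first anchor.

  By polarization, the four anchor intensities determine the moduli of both anchors and the
  real and imaginary part of \<open>p * cnj q\<close>, hence the relative phase of the anchors: any solution
  is the true pair \<open>(p, q)\<close> multiplied by one unit scalar \<open>u\<close>
  (\<open>anchors_unique_up_to_phase\<close>).

  After division by \<open>u\<close>, each further entry has prescribed distances to the three points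
  \<open>0\<close>, \<open>p\<close>, \<open>q\<close> of the real plane. Subtracting the first squared distance from the other two
  leaves two linear equations, saying that the difference of two solutions is orthogonal to
  \<open>p\<close> and to \<open>q\<close>; as these span the plane, the solution is unique
  (\<open>trilateration\<close>). Hence every output is \<open>u\<close> times the unknown vector, with the same \<open>u\<close>
  for all entries. An output exists because the unknown vector itself satisfies every equation.
\<close>

section \<open>Plane geometry of the two stages\<close>

lemma orthogonal_to_noncollinear_imp_0:
  fixes d p q :: complex
  assumes nc: "\<not> collinear {0, p, q}" and "d \<bullet> p = 0" and "d \<bullet> q = 0"
  shows "d = 0"
proof -
  have p0: "p \<noteq> 0" and no_multiple: "\<And>r. q \<noteq> r *\<^sub>R p"
    using nc by (auto simp: collinear_lemma)
  let ?det = "Re p * Im q - Im p * Re q"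
  have det: "?det \<noteq> 0"
  proof
    assume "?det = 0"
    then have "q * cnj p = complex_of_real (q \<bullet> p)"
      by (simp add: complex_eq_iff inner_complex_def algebra_simps)
    then have "(q * cnj p) * p = complex_of_real (q \<bullet> p) * p"
      by simp
    moreover have "(q * cnj p) * p = q * (p * cnj p)"
      by simp
    ultimately have "q * complex_of_real ((cmod p)\<^sup>2) = complex_of_real (q \<bullet> p) * p"
      by (simp only: complex_norm_square)
    then have "q = complex_of_real (q \<bullet> p) * p / complex_of_real ((cmod p)\<^sup>2)"
      using p0 by (simp add: eq_divide_eq)
    then have "q = ((q \<bullet> p) / (cmod p)\<^sup>2) *\<^sub>R p"
      by (simp add: scaleR_conv_of_real)
    with no_multiple show False by blast
  qed
  have eqs: "Re d * Re p + Im d * Im p = 0" "Re d * Re q + Im d * Im q = 0"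
    using assms by (simp_all add: inner_complex_def)
  \<comment> \<open>Cramer's rule for the homogeneous system.\<close>
  have "Re d * ?det = Im q * (Re d * Re p + Im d * Im p) - Im p * (Re d * Re q + Im d * Im q)"
    and "Im d * ?det = Re p * (Re d * Re q + Im d * Im q) - Re q * (Re d * Re p + Im d * Im p)"
    by (simp_all add: algebra_simps)
  then have "Re d * ?det = 0" and "Im d * ?det = 0"
    by (simp_all only: eqs mult_zero_right diff_self)
  with det show ?thesis by (simp add: complex_eq_iff)
qed

text \<open>The quadratic terms cancel when squared distances to the origin and to \<open>p\<close> are compared;
  what remains is linear in the unknown point.\<close>

lemma equidistant_imp_orthogonal:
  fixes c d p :: "'a::real_inner"
  assumes "(norm c)\<^sup>2 = (norm d)\<^sup>2" and "(norm (c - p))\<^sup>2 = (norm (d - p))\<^sup>2"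
  shows "(c - d) \<bullet> p = 0"
  using assms by (simp add: power2_norm_eq_inner inner_diff inner_commute)

lemma trilateration:
  fixes c d p q :: complex
  assumes "\<not> collinear {0, p, q}"
    and "(cmod c)\<^sup>2 = (cmod d)\<^sup>2"
    and "(cmod (c - p))\<^sup>2 = (cmod (d - p))\<^sup>2"
    and "(cmod (c - q))\<^sup>2 = (cmod (d - q))\<^sup>2"
  shows "c = d"
proof -
  have "c - d = 0"
    using assms by (intro orthogonal_to_noncollinear_imp_0[of p q] equidistant_imp_orthogonal)
  then show ?thesis by simp
qed

text \<open>Here the anchors are known only up to the unit \<open>u\<close>; rotating the picture back by \<open>u\<close>
  preserves all distances.\<close>

lemma trilateration_rotated:
  fixes c d p q u :: complex
  assumes "\<not> collinear {0, p, q}" and u: "cmod u = 1"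
    and "(cmod c)\<^sup>2 = (cmod d)\<^sup>2"
    and "(cmod (c - u * p))\<^sup>2 = (cmod (d - p))\<^sup>2"
    and "(cmod (c - u * q))\<^sup>2 = (cmod (d - q))\<^sup>2"
  shows "c = u * d"
proof -
  have u0: "u \<noteq> 0" using u by auto
  have rotate: "cmod (c / u - z) = cmod (c - u * z)" for z
  proof -
    have "c - u * z = u * (c / u - z)"
      using u0 by (simp add: field_simps)
    then show ?thesis by (simp add: norm_mult u)
  qed
  have "c / u = d"
    using assms rotate[of 0] by (intro trilateration[of p q]) (simp_all add: rotate)
  with u0 show ?thesis by (simp add: field_simps)
qed

lemma anchors_unique_up_to_phase:
  fixes a b p q :: complex
  assumes p0: "p \<noteq> 0"
    and a: "(cmod a)\<^sup>2 = (cmod p)\<^sup>2"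
    and b: "(cmod b)\<^sup>2 = (cmod q)\<^sup>2"
    and plus: "(cmod (a + b))\<^sup>2 = (cmod (p + q))\<^sup>2"
    and plus_i: "(cmod (a + \<i> * b))\<^sup>2 = (cmod (p + \<i> * q))\<^sup>2"
  obtains u where "cmod u = 1" and "a = u * p" and "b = u * q"
proof
  have norms: "cmod a = cmod p"
    using a by simp
  have a0: "a \<noteq> 0" using norms p0 by auto
  \<comment> \<open>The two mixed intensities give the real and the imaginary part of this equation.\<close>
  have "a * cnj b = p * cnj q"
    using a b plus plus_i unfolding cmod_power2
    by (simp add: complex_eq_iff power2_eq_square algebra_simps)
  from arg_cong[OF this, of cnj] have "cnj a * b = cnj p * q"
    by simp
  moreover have "a * cnj a = p * cnj p"
    by (simp add: complex_norm_square[symmetric] norms)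
  ultimately have "p * (cnj a * b) = p * (cnj p * q)" and "q * (a * cnj a) = q * (p * cnj p)"
    by simp_all
  then have "cnj a * (b * p) = cnj a * (a * q)"
    by (simp only: ac_simps)
  then have "b * p = a * q" using a0 by simp
  then show "b = a / p * q" using p0 by (simp add: field_simps)
  show "a = a / p * p" using p0 by simp
  show "cmod (a / p) = 1" using norms p0 by (simp add: norm_divide)
qed

section \<open>The measurements as functions of the entries\<close>

lemma conjugate_unit_vec: "conjugate (unit_vec n i) = (unit_vec n i :: complex vec)"
  by (intro eq_vecI) (auto simp: unit_vec_def)

lemma intensity_unit:
  assumes "x \<in> carrier_vec n" and "i < n"
  shows "intensity x (unit_vec n i) = (cmod (x $ i))\<^sup>2"
  using assms by (simp add: intensity_def conjugate_unit_vec)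

context
  fixes x :: "complex vec" and n i j :: nat
  assumes x: "x \<in> carrier_vec n" and i: "i < n" and j: "j < n"
begin

lemma intensity_add:
  "intensity x (unit_vec n i + unit_vec n j) = (cmod (x $ i + x $ j))\<^sup>2"
  using x i j
  by (simp add: intensity_def conjugate_add_vec[of _ n] conjugate_unit_vec
      scalar_prod_add_distrib[of _ n])

lemma intensity_diff:
  "intensity x (unit_vec n i - unit_vec n j) = (cmod (x $ i - x $ j))\<^sup>2"
proof -
  have "conjugate (unit_vec n i - unit_vec n j :: complex vec) = unit_vec n i - unit_vec n j"
    by (intro eq_vecI) (auto simp: unit_vec_def)
  then show ?thesis
    using x i j by (simp add: intensity_def scalar_prod_minus_distrib[of _ n])
qed

text \<open>The inner product is conjugate linear in its second argument, which turns \<open>- \<i>\<close> into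
  \<open>\<i>\<close>.\<close>

lemma intensity_diff_i:
  "intensity x (unit_vec n i - \<i> \<cdot>\<^sub>v unit_vec n j) = (cmod (x $ i + \<i> * x $ j))\<^sup>2"
proof -
  have "conjugate (unit_vec n i - \<i> \<cdot>\<^sub>v unit_vec n j :: complex vec)
      = unit_vec n i + \<i> \<cdot>\<^sub>v unit_vec n j"
    by (intro eq_vecI) (auto simp: unit_vec_def)
  then show ?thesis
    using x i j by (simp add: intensity_def scalar_prod_add_distrib[of _ n])
qed

end

lemma detected_support_intensity:
  assumes "x \<in> carrier_vec n"
  shows "detected_support n (intensity x) = filter (\<lambda>j. x $ j \<noteq> 0) [0..<n]"
  using assms by (auto simp: detected_support_def intensity_unit intro!: filter_cong)

lemma filter_upt_first_two:
  assumes "j1 < j2" and "j2 < n" and "P j1" and "P j2"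
    and none: "\<forall>j<j2. j \<noteq> j1 \<longrightarrow> \<not> P j"
  shows "filter P [0..<n] = j1 # j2 # filter P [Suc j2..<n]"
proof -
  have "[0..<n] = [0..<j1] @ j1 # [Suc j1..<j2] @ j2 # [Suc j2..<n]"
  proof -
    have "[0..<n] = [0..<j1] @ [j1..<n]" and "[Suc j1..<n] = [Suc j1..<j2] @ [j2..<n]"
      using assms(1,2) upt_add_eq_append[of 0 j1 "n - j1"]
        upt_add_eq_append[of "Suc j1" j2 "n - j2"] by simp_all
    then show ?thesis
      using assms(1,2) upt_conv_Cons[of j1 n] upt_conv_Cons[of j2 n] by simp
  qed
  moreover have "filter P [0..<j1] = []" "filter P [Suc j1..<j2] = []"
    using none \<open>j1 < j2\<close> by (auto simp: filter_empty_conv)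
  ultimately show ?thesis using assms(3,4) by simp
qed

lemma phase_equivI:
  assumes x: "x \<in> carrier_vec n" and y: "y \<in> carrier_vec n" and u: "cmod u = 1"
    and eq: "\<And>j. j < n \<Longrightarrow> y $ j = u * x $ j"
  shows "x \<sim>\<^sub>p y"
proof -
  have "u = exp (\<i> * complex_of_real (Arg u))"
    using rcis_cmod_Arg[of u] u by (simp add: rcis_def cis_conv_exp)
  moreover have "y = u \<cdot>\<^sub>v x"
    using x y eq by (intro eq_vecI) auto
  ultimately show ?thesis unfolding phase_equiv_def by metis
qed

section \<open>Exact recovery\<close>

theorem theorem3:
  fixes n j1 j2 :: nat and x :: "complex vec"
  assumes "x \<in> carrier_vec n"
    and "j1 < j2" and "j2 < n"
    and "x $ j1 \<noteq> 0" and "x $ j2 \<noteq> 0"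
    and "\<forall>j<j2. j \<noteq> j1 \<longrightarrow> x $ j = 0"
    and "\<not> collinear {0, x $ j1, x $ j2}"
  shows "(\<exists>y. two_stage_output n (intensity x) y) \<and>
         (\<forall>y. two_stage_output n (intensity x) y \<longrightarrow> x \<sim>\<^sub>p y)"
proof -
  note x = \<open>x \<in> carrier_vec n\<close>
  have j1: "j1 < n" and j2: "j2 < n" using assms by auto
  let ?m = "intensity x"
  define J where "J = detected_support n ?m"
  have J_eq: "J = filter (\<lambda>j. x $ j \<noteq> 0) [0..<n]"
    by (simp add: J_def detected_support_intensity[OF x])
  have J_Cons: "J = j1 # j2 # filter (\<lambda>j. x $ j \<noteq> 0) [Suc j2..<n]"
    unfolding J_eq using assms by (intro filter_upt_first_two) auto
  have set_J: "set J = {j. j < n \<and> x $ j \<noteq> 0}"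
    by (auto simp: J_eq)
  have J01: "J ! 0 = j1" "J ! 1 = j2" "2 \<le> length J"
    by (simp_all add: J_Cons)
  have nth_J: "J ! k < n" if "k < length J" for k
    using nth_mem[OF that] by (simp add: set_J)
  note two_stage_output_J = two_stage_output_def[of n ?m, folded J_def, unfolded Let_def J01]
  note measurements = anchors_localized_def entry_solved_def intensity_unit[OF x]
    intensity_add[OF x] intensity_diff[OF x] intensity_diff_i[OF x]
  have "two_stage_output n ?m x"
    unfolding two_stage_output_J
    using x j1 j2 J01 by (auto simp: measurements nth_J set_J)
  moreover have "x \<sim>\<^sub>p y" if out: "two_stage_output n ?m y" for y
  proof -
    have y: "y \<in> carrier_vec n"
      and anchors: "anchors_localized n ?m j1 j2 (y $ j1) (y $ j2)"
      and entries: "\<And>k. k \<in> {2..<length J} \<Longrightarrow>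
        entry_solved n ?m j1 j2 (y $ j1) (y $ j2) (J ! k) (y $ (J ! k))"
      and zeros: "\<And>j. j < n \<Longrightarrow> j \<notin> set J \<Longrightarrow> y $ j = 0"
      using out unfolding two_stage_output_J by blast+
    obtain u where u: "cmod u = 1" and yj1: "y $ j1 = u * x $ j1" and yj2: "y $ j2 = u * x $ j2"
      using anchors_unique_up_to_phase[of "x $ j1" "y $ j1" "y $ j2" "x $ j2"]
        anchors j1 j2 \<open>x $ j1 \<noteq> 0\<close>
      by (auto simp: measurements)
    have later: "y $ (J ! k) = u * x $ (J ! k)" if k: "k \<in> {2..<length J}" for k
      using entries[OF k] k j1 j2 nth_J[of k] yj1 yj2
      by (intro trilateration_rotated[OF assms(7) u]) (simp_all add: measurements)
    have "y $ j = u * x $ j" if j: "j < n" for j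
    proof (cases "j \<in> set J")
      case True
      then obtain k where k: "k < length J" "j = J ! k"
        by (auto simp: in_set_conv_nth)
      consider "k = 0" | "k = 1" | "k \<in> {2..<length J}"
        using k(1) by fastforce
      then show ?thesis
        using J01 yj1 yj2 later k(2) by cases auto
    next
      case False
      then show ?thesis using zeros[OF j] j by (simp add: set_J)
    qed
    then show ?thesis using phase_equivI[OF x y u] by blast
  qed
  ultimately show ?thesis by blast
qed

end
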